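(* There exists a sequence $\{Q_n\}_{n\in\mathbb{N}}$ of quadrature formulas on $\mathbb{S}^2$, $Q_n(f)=\sum_{j=1}^{N_n}w_j^{(n)}f(\mathbf{x}_j^{(n)})$, such that (i) there is a constant $M>0$ independent of $n$ with $\sup_{n\in\mathbb{N}}\sum_{j=1}^{N_n}|w_j^{(n)}|\leq M$ (uniform P\'olya stability condition); (ii) $\lim_{n\to\infty}|Q_n(p)-I(p)|=0$ for all $p\in\mathbb{P}(\mathbb{S}^2)$ (asymptotic approximation property for polynomials); and the associated degree-$n$ hyperinterpolation operators $L_n:=L_{n,Q_n}$ satisfy $$\lim_{n\to\infty}\|L_n\|_{C(\mathbb{S}^2)\to L^2(\mathbb{S}^2)}=\infty.$$ Consequently, there exists $f\in C(\mathbb{S}^2)$ such that $\limsup_{n\to\infty}\|L_nf\|_{L^2(\mathbb{S}^2)}=\infty$.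
   Context: $\mathbb{S}^2=\{\mathbf{x}\in\mathbb{R}^3:\|\mathbf{x}\|_2=1\}$ carries the surface measure $\omega$ with $\omega(\mathbb{S}^2)=4\pi$; $C(\mathbb{S}^2)$ is the space of real-valued continuous functions with the uniform norm $\|\cdot\|_\infty$; $L^2(\mathbb{S}^2)$ is taken with respect to $\omega$; $I(f)=\int_{\mathbb{S}^2}f\,d\omega$. $\mathbb{N}=\{1,2,\ldots\}$. $\mathbb{H}_\ell$ is the space of spherical harmonics of degree $\ell$ (restrictions to $\mathbb{S}^2$ of real harmonic homogeneous polynomials of degree $\ell$ on $\mathbb{R}^3$), $\{Y_{\ell,k}: |k|\le \ell\}$ is an $L^2(\mathbb{S}^2)$-orthonormal basis of $\mathbb{H}_\ell$, $\mathbb{P}_n(\mathbb{S}^2)=\bigoplus_{\ell=0}^n\mathbb{H}_\ell$, and $\mathbb{P}(\mathbb{S}^2)=\bigoplus_{\ell=0}^\infty\mathbb{H}_\ell$ is the space of all spherical polynomials. A quadrature formula is a linear functional $Q(f)=\sum_{j=1}^N w_jf(\mathbf{x}_j)$ on $C(\mathbb{S}^2)$ given by $N$ pairwise distinct nodes $\mathbf{x}_1,\ldots,\mathbf{x}_N\in\mathbb{S}^2$ and arbitrary real (possibly signed) weights. In a sequence $\{Q_n\}$, the nodes, weights and number of nodes $N_n$ may all depend on $n$. The degree-$n$ hyperinterpolation operator associated with $Q$ is $L_{n,Q}:C(\mathbb{S}^2)\to\mathbb{P}_n(\mathbb{S}^2)$, $L_{n,Q}f:=\sum_{\ell=0}^n\sum_{k=-\ell}^{\ell}Q(fY_{\ell,k})\,Y_{\ell,k}$,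 with operator norm $\|L_{n,Q}\|_{C(\mathbb{S}^2)\to L^2(\mathbb{S}^2)}=\sup_{\|f\|_\infty\le1}\|L_{n,Q}f\|_{L^2(\mathbb{S}^2)}$. *)

theory Defs
  imports "HOL-Analysis.Analysis"
begin

definition S2 :: "(real^3) set" where
  "S2 = sphere 0 1"

(* Surface measure, given as the cone measure: the surface measure of A is
   3 times the Lebesgue measure of {t *R x | x : A, 0 < t <= 1}
   (polar coordinates: the cone over A has volume omega(A) * (int_0^1 t^2 dt)).
   The origin, a null set, is removed so that sgn x = x / norm x maps into S2. *)
definition surface_measure :: "(real^3) measure" where
  "surface_measure =
     scale_measure 3 (distr (restrict_space lborel (cball 0 1 - {0})) (restrict_space borel S2) sgn)"

definition C_S2 :: "(real^3 \<Rightarrow> real) set" where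
  "C_S2 = {f. continuous_on S2 f}"

definition sup_norm :: "(real^3 \<Rightarrow> real) \<Rightarrow> real" where
  "sup_norm f = (SUP x\<in>S2. \<bar>f x\<bar>)"

definition sphere_integral :: "(real^3 \<Rightarrow> real) \<Rightarrow> real" where
  "sphere_integral f = (LINT x|surface_measure. f x)"

definition L2_inner :: "(real^3 \<Rightarrow> real) \<Rightarrow> (real^3 \<Rightarrow> real) \<Rightarrow> real" where
  "L2_inner f g = sphere_integral (\<lambda>x. f x * g x)"

definition L2_norm :: "(real^3 \<Rightarrow> real) \<Rightarrow> real" where
  "L2_norm f = sqrt (L2_inner f f)"

definition partial_deriv :: "3 \<Rightarrow> (real^3 \<Rightarrow> real) \<Rightarrow> real^3 \<Rightarrow> real" where
  "partial_deriv i f x = deriv (\<lambda>t. f (x + t *\<^sub>R axis i 1)) 0"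

definition laplacian :: "(real^3 \<Rightarrow> real) \<Rightarrow> real^3 \<Rightarrow> real" where
  "laplacian f x = (\<Sum>i\<in>UNIV. partial_deriv i (partial_deriv i f) x)"

definition homogeneous_polynomial :: "nat \<Rightarrow> (real^3 \<Rightarrow> real) \<Rightarrow> bool" where
  "homogeneous_polynomial l p \<longleftrightarrow>
     real_polynomial_function p \<and> (\<forall>t x. p (t *\<^sub>R x) = t ^ l * p x)"

definition spherical_harmonics :: "nat \<Rightarrow> (real^3 \<Rightarrow> real) set" where
  "spherical_harmonics l =
     {restrict p S2 | p. homogeneous_polynomial l p \<and> (\<forall>x. laplacian p x = 0)}"

definition spherical_polynomials_upto :: "nat \<Rightarrow> (real^3 \<Rightarrow> real) set" where
  "spherical_polynomials_upto n =
     {restrict (\<lambda>x. \<Sum>l\<le>n. h l x) S2 | h. \<forall>l\<le>n. h l \<in> spherical_harmonics l}"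

definition spherical_polynomials :: "(real^3 \<Rightarrow> real) set" where
  "spherical_polynomials = (\<Union>n. spherical_polynomials_upto n)"

definition harmonic_onb :: "nat \<Rightarrow> (int \<Rightarrow> real^3 \<Rightarrow> real) \<Rightarrow> bool" where
  "harmonic_onb l Y \<longleftrightarrow>
     (\<forall>k\<in>{- int l..int l}. Y k \<in> spherical_harmonics l) \<and>
     (\<forall>j\<in>{- int l..int l}. \<forall>k\<in>{- int l..int l}. L2_inner (Y j) (Y k) = (if j = k then 1 else 0)) \<and>
     (\<forall>h\<in>spherical_harmonics l. \<exists>c. \<forall>x\<in>S2. h x = (\<Sum>k=- int l..int l. c k * Y k x))"

(* Only the nodes and weights with index in {1..num_nodes} are meaningful. *)
record quadrature =
  num_nodes :: nat
  node :: "nat \<Rightarrow> real^3"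
  weight :: "nat \<Rightarrow> real"

definition quadrature_formula :: "quadrature \<Rightarrow> bool" where
  "quadrature_formula Q \<longleftrightarrow>
     num_nodes Q \<ge> 1 \<and> node Q ` {1..num_nodes Q} \<subseteq> S2 \<and> inj_on (node Q) {1..num_nodes Q}"

definition quad_apply :: "quadrature \<Rightarrow> (real^3 \<Rightarrow> real) \<Rightarrow> real" where
  "quad_apply Q f = (\<Sum>j=1..num_nodes Q. weight Q j * f (node Q j))"

definition hyperinterpolation ::
  "(nat \<Rightarrow> int \<Rightarrow> real^3 \<Rightarrow> real) \<Rightarrow> nat \<Rightarrow> quadrature \<Rightarrow> (real^3 \<Rightarrow> real) \<Rightarrow> real^3 \<Rightarrow> real" where
  "hyperinterpolation Y n Q f =
     restrict (\<lambda>x. \<Sum>l\<le>n. \<Sum>k=- int l..int l. quad_apply Q (\<lambda>y. f y * Y l k y) * Y l k x) S2"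

(* Extended real valued, so that the supremum needs no boundedness side condition. *)
definition op_norm_C_L2 :: "((real^3 \<Rightarrow> real) \<Rightarrow> real^3 \<Rightarrow> real) \<Rightarrow> ereal" where
  "op_norm_C_L2 T = (SUP f\<in>{f\<in>C_S2. sup_norm f \<le> 1}. ereal (L2_norm (T f)))"

lemma sgn_measurable_S2:
  "sgn \<in> restrict_space lborel (cball 0 1 - {0}) \<rightarrow>\<^sub>M restrict_space borel S2"
proof (rule measurable_restrict_space2)
  show "sgn \<in> space (restrict_space lborel (cball 0 1 - {0 :: real^3})) \<rightarrow> S2"
    by (auto simp: S2_def space_restrict_space norm_sgn)
  have "sgn \<in> borel_measurable (borel :: (real^3) measure)"
    unfolding sgn_div_norm by measurable
  then show "sgn \<in> borel_measurable (restrict_space lborel (cball 0 1 - {0 :: real^3}))"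
    by (intro measurable_restrict_space1) auto
qed

lemma space_surface_measure [simp]: "space surface_measure = S2"
  by (simp add: surface_measure_def space_scale_measure space_restrict_space)

lemma sets_surface_measure: "sets surface_measure = sets (restrict_space borel S2)"
  by (simp add: surface_measure_def)

lemma emeasure_surface_measure:
  assumes "A \<in> sets (restrict_space borel S2)"
  shows "emeasure surface_measure A = 3 * emeasure lborel {x \<in> cball 0 1 - {0}. sgn x \<in> A}"
proof -
  let ?B = "cball 0 1 - {0 :: real^3}"
  have "emeasure surface_measure A =
      3 * emeasure (restrict_space lborel ?B) (sgn -` A \<inter> space (restrict_space lborel ?B))"
    unfolding surface_measure_def
    using assms by (simp add: emeasure_distr[OF sgn_measurable_S2])
  also have "sgn -` A \<inter> space (restrict_space lborel ?B) = {x \<in> ?B. sgn x \<in> A}"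
    by (auto simp: space_restrict_space)
  also have "emeasure (restrict_space lborel ?B) {x \<in> ?B. sgn x \<in> A}
      = emeasure lborel {x \<in> ?B. sgn x \<in> A}"
    by (rule emeasure_restrict_space) auto
  finally show ?thesis .
qed

lemma emeasure_surface_measure_S2: "emeasure surface_measure S2 = ennreal (4 * pi)"
proof -
  have S: "S2 \<in> sets (restrict_space borel S2)"
    by (simp add: S2_def sets_restrict_space_iff)
  have eq: "{x \<in> cball 0 1 - {0}. sgn x \<in> S2} = cball 0 1 - {0 :: real^3}"
    by (auto simp: S2_def norm_sgn)
  have "emeasure lborel (cball 0 1 - {0 :: real^3}) = emeasure lborel (cball 0 1 :: (real^3) set)"
    by (subst emeasure_Diff) auto
  also have "\<dots> = ennreal (4 / 3 * pi)"
    by (simp add: emeasure_cball unit_ball_vol_3)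
  finally have "emeasure surface_measure S2 = ennreal 3 * ennreal (4 / 3 * pi)"
    using emeasure_surface_measure[OF S] eq by simp
  also have "\<dots> = ennreal (4 * pi)"
    by (subst ennreal_mult[symmetric]) auto
  finally show ?thesis .
qed

end

theory Submission
  imports Defs
begin

text \<open>Add to a convergent Riemann sum, whose nodes avoid the equator, the alternating mean
  \<open>A f = (\<Sum>j<2n. (-1)^j f (x_j)) / (2n)\<close> over \<open>2n\<close> equally spaced points of the equator. It has total
  weight 1 and annihilates every harmonic of degree below \<open>n\<close>, so it does not disturb the limit on polynomials.
  Let \<open>f\<close> be a bump function equal to 1 on the equator and 0 on the Riemann nodes. Then the degree \<open>n\<close>
  hyperinterpolant of \<open>f\<close> lies in the top degree alone, and its inner product with the sectoral harmonic
  \<open>h = Re ((x + i y)^n)\<close> is \<open>A h = 1\<close>. As \<open>h\<close> tends to 0 in \<open>L^2\<close>, the Cauchy-Schwarz inequality makes the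
  operator norm tend to infinity; the last claim is then the uniform boundedness principle. Since
  the lower degrees vanish identically, orthogonality between different degrees never enters.\<close>

section \<open>Uniform boundedness\<close>

text \<open>Baire category: the closed sets \<open>A k\<close>, where all \<open>F n\<close> are
  bounded by \<open>k\<close>, cover the complete space, so one of them contains a ball. Translating
  that ball to the origin and scaling gives a bound for all \<open>x\<close>.\<close>

lemma uniform_boundedness:
  fixes F :: "nat \<Rightarrow> 'a::{real_normed_vector, complete_space} \<Rightarrow> 'b::real_normed_vector"
  assumes lin: "\<And>n. bounded_linear (F n)"
    and bdd: "\<And>x. \<exists>B. \<forall>n. norm (F n x) \<le> B"
  shows "\<exists>C. \<forall>n x. norm (F n x) \<le> C * norm x"
proof -
  define A where "A k = {x. \<forall>n. norm (F n x) \<le> real k}" for k :: nat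
  have closed: "closed (A k)" for k
  proof -
    have "A k = (\<Inter>n. {x. norm (F n x) \<le> real k})" by (auto simp: A_def)
    moreover have "closed {x. norm (F n x) \<le> real k}" for n
      by (intro closed_Collect_le continuous_intros linear_continuous_on[OF lin])
    ultimately show ?thesis by auto
  qed
  have un: "\<Union> (range A) = UNIV"
  proof -
    have "\<exists>k. x \<in> A k" for x
    proof -
      obtain B where "\<forall>n. norm (F n x) \<le> B" using bdd by blast
      moreover obtain k :: nat where "B \<le> real k" using real_arch_simple by blast
      ultimately have "\<forall>n. norm (F n x) \<le> real k" by (meson order_trans)
      then show ?thesis by (auto simp: A_def)
    qed
    then show ?thesis by blast
  qed
  have "\<exists>k. interior (A k) \<noteq> {}"
  proof (rule ccontr)
    assume "\<nexists>k. interior (A k) \<noteq> {}"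
    then have "(euclidean :: 'a topology) interior_of (\<Union> (range A)) = {}"
      using closed by (intro Baire_category_alt) (auto simp: completely_metrizable_space_euclidean)
    then show False using un by simp
  qed
  then obtain k a where "a \<in> interior (A k)" by blast
  then obtain e where e: "e > 0" "cball a e \<subseteq> A k"
    using mem_interior_cball by blast
  have "norm (F n x) \<le> 2 * real k / e * norm x" for n x
  proof (cases "x = 0")
    case True
    then show ?thesis using linear_0[OF bounded_linear.linear[OF lin]] by simp
  next
    case False
    \<comment> \<open>Both \<open>a\<close> and \<open>a + y\<close> lie in the ball of radius
      \<open>e\<close>, so \<open>F n y\<close>, the difference of the values there, has norm at
      most \<open>2 * real k\<close>.\<close>
    define y where "y = (e / norm x) *\<^sub>R x"
    interpret bounded_linear "F n" by (rule lin)
    have "norm y = e" using False e by (simp add: y_def)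
    then have "a + y \<in> A k" "a \<in> A k" using e by (auto simp: dist_norm)
    then have "norm (F n (a + y)) \<le> real k" "norm (F n a) \<le> real k" by (auto simp: A_def)
    then have "norm (F n y) \<le> 2 * real k"
      using norm_triangle_ineq4[of "F n (a + y)" "F n a"] by (simp add: add)
    also have "F n y = (e / norm x) *\<^sub>R F n x" by (simp add: y_def scaleR)
    finally show ?thesis using e False by (simp add: field_simps)
  qed
  then show ?thesis by blast
qed

section \<open>Alternating sums on the equator\<close>

text \<open>On the equatorial plane x = (z + w)/2 and y = (z - w)/(2i) with w =
  \<open>cnj z\<close>, so a real polynomial becomes a polynomial in z and w. The outer variable of
  \<open>P\<close> stands for z, the inner one for w.\<close>

lemma circle_polynomial:
  fixes p :: "real^3 \<Rightarrow> real"
  assumes "real_polynomial_function p"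
  shows "\<exists>P :: complex poly poly. \<forall>z.
    complex_of_real (p (vector [Re z, Im z, 0])) = poly (poly P [:z:]) (cnj z)"
  using assms
proof (induction rule: real_polynomial_function.induct)
  case (linear f)
  interpret bounded_linear f by (rule linear)
  let ?a = "complex_of_real (f (axis 1 1))" and ?b = "complex_of_real (f (axis 2 1))"
  \<comment> \<open>This regroups a x + b y as w (a/2 - b/(2i)) + z (a/2 + b/(2i)).\<close>
  let ?P = "[:[:0, ?a / 2 - ?b / (2 * \<i>):], [:?a / 2 + ?b / (2 * \<i>):]:]"
  have "complex_of_real (f (vector [Re z, Im z, 0])) = poly (poly ?P [:z:]) (cnj z)" for z
  proof -
    have "vector [Re z, Im z, 0] = Re z *\<^sub>R axis 1 1 + Im z *\<^sub>R axis 2 (1::real) + 0 *\<^sub>R (axis 3 1 :: real^3)"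
      by (simp add: vec_eq_iff forall_3 axis_def)
    then have "f (vector [Re z, Im z, 0]) = Re z * f (axis 1 1) + Im z * f (axis 2 1)"
      by (simp add: add scaleR)
    then show ?thesis by (simp add: complex_eq_iff field_simps)
  qed
  then show ?case by blast
next
  case (const c)
  show ?case by (rule exI[of _ "[:[:complex_of_real c:]:]"]) simp
next
  case (add f g)
  then obtain P Q where "\<forall>z. complex_of_real (f (vector [Re z, Im z, 0])) = poly (poly P [:z:]) (cnj z)"
    "\<forall>z. complex_of_real (g (vector [Re z, Im z, 0])) = poly (poly Q [:z:]) (cnj z)" by blast
  then show ?case by (intro exI[of _ "P + Q"]) simp
next
  case (mult f g)
  then obtain P Q where "\<forall>z. complex_of_real (f (vector [Re z, Im z, 0])) = poly (poly P [:z:]) (cnj z)"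
    "\<forall>z. complex_of_real (g (vector [Re z, Im z, 0])) = poly (poly Q [:z:]) (cnj z)" by blast
  then show ?case by (intro exI[of _ "P * Q"]) simp
qed

text \<open>Exposes the monomials z^a w^b, so that alternating sums can be taken term by
  term.\<close>

lemma poly_poly_eq_sum:
  fixes P :: "complex poly poly"
  shows "poly (poly P [:z:]) w = (\<Sum>a\<le>degree P. \<Sum>b\<le>degree (coeff P a). coeff (coeff P a) b * (z ^ a * w ^ b))"
proof -
  have "poly P [:z:] = (\<Sum>a\<le>degree P. smult (z ^ a) (coeff P a))"
    by (simp only: poly_altdef[of P] poly_const_pow) (simp add: mult.commute)
  then have "poly (poly P [:z:]) w = (\<Sum>a\<le>degree P. z ^ a * poly (coeff P a) w)"
    by (simp add: poly_sum)
  then show ?thesis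
    by (simp only: poly_altdef sum_distrib_left mult.left_commute)
qed

text \<open>Since (-1)^j is the n-th power of \<open>z j\<close> and conjugation inverts
  \<open>z j\<close>, the sum is geometric with ratio \<open>cis t\<close>, a 2n-th root of unity.
  The ratio is not 1 because n + a - b lies strictly between 0 and 2n.\<close>

lemma alternating_sum_roots_of_unity:
  fixes a b n :: nat
  assumes "a + b < n"
  defines "z \<equiv> (\<lambda>j. cis (pi * real j / real n))"
  shows "(\<Sum>j<2*n. (-1) ^ j * (z j ^ a * cnj (z j) ^ b)) = 0"
proof -
  define t where "t = pi * (real n + real a - real b) / real n"
  have n: "n > 0" using assms by simp
  have "(-1) ^ j * (z j ^ a * cnj (z j) ^ b) = cis t ^ j" for j
  proof -
    have "(-1::complex) ^ j = cis (real j * pi)" using Complex.DeMoivre[of pi j] by (simp only: cis_pi)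
    moreover have "real j * pi + (real a * \<theta> + real b * - \<theta>) = real j * t"
      if "\<theta> = pi * real j / real n" for \<theta>
      using n unfolding that t_def by (simp add: field_simps)
    ultimately show ?thesis
      by (simp add: z_def Complex.DeMoivre cis_mult cis_cnj)
  qed
  moreover have "cis t \<noteq> 1"
  proof
    assume "cis t = 1"
    then have "cos t = 1" by (metis cis.sel(1) one_complex.sel(1))
    then obtain k :: int where "t = 2 * pi * k" by (auto simp: cos_one_2pi_int mult_ac)
    then have "pi * (real n + real a - real b) = pi * real_of_int (2 * k * int n)"
      using n by (simp add: t_def field_simps)
    then have "real n + real a - real b = real_of_int (2 * k * int n)"
      by (subst (asm) mult_cancel_left) simp
    then have k: "int n + int a - int b = 2 * k * int n" by linarith
    have "k * int n > 0" "2 * (k * int n) < 2 * int n" using assms k by linarith+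
    then have "k > 0" "k < 1" using n by (auto simp: zero_less_mult_iff)
    then show False by simp
  qed
  moreover have "cis t ^ (2 * n) = 1"
  proof -
    have "real (2 * n) * t = 2 * pi * real_of_int (int n + int a - int b)"
      using n by (simp add: t_def)
    then have "cis t ^ (2 * n) = cis (2 * pi * real_of_int (int n + int a - int b))"
      by (simp only: Complex.DeMoivre)
    also have "\<dots> = 1" by (rule cis_multiple_2pi) (rule Ints_of_int)
    finally show ?thesis .
  qed
  ultimately show ?thesis by (simp add: sum_gp_strict)
qed

definition circle_node :: "nat \<Rightarrow> nat \<Rightarrow> real^3" where
  "circle_node n j = vector [cos (pi * real j / real n), sin (pi * real j / real n), 0]"

text \<open>With z, w the conjugate coordinates of the equatorial plane, the alternating sum kills every
  monomial z^a w^b with a + b < n, so along the ray s the sum is O(s^n); for a homogeneous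
  polynomial of degree l < n it is also a multiple of s^l, hence zero.\<close>
lemma alternating_sum_homogeneous:
  assumes p: "homogeneous_polynomial l p" and l: "l < n"
  shows "(\<Sum>j<2*n. (-1) ^ j * p (circle_node n j)) = 0"
proof -
  define z where "z j = cis (pi * real j / real n)" for j :: nat
  define G where "G = (\<Sum>j<2*n. (-1) ^ j * p (circle_node n j))"
  obtain P where P: "\<And>z. complex_of_real (p (vector [Re z, Im z, 0])) = poly (poly P [:z:]) (cnj z)"
    using circle_polynomial p unfolding homogeneous_polynomial_def by blast
  define \<kappa> where "\<kappa> a b = coeff (coeff P a) b * (\<Sum>j<2*n. (-1) ^ j * (z j ^ a * cnj (z j) ^ b))" for a b
  \<comment> \<open>The expansion along the ray \<open>s\<close>, divided by s^n. The natural
    subtraction \<open>a + b - n\<close> truncates only where \<open>\<kappa> a b\<close> is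
    0.\<close>
  define R where "R s = (\<Sum>a\<le>degree P. \<Sum>b\<le>degree (coeff P a).
      \<kappa> a b * complex_of_real s ^ (a + b - n))" for s
  have \<kappa>: "\<kappa> a b * x ^ (a + b) = x ^ n * (\<kappa> a b * x ^ (a + b - n))" for a b x
  proof (cases "a + b < n")
    case True
    then show ?thesis using alternating_sum_roots_of_unity[OF True] by (simp add: \<kappa>_def z_def)
  next
    case False
    then show ?thesis by (simp flip: power_add)
  qed
  have scaled: "complex_of_real (s ^ l * G) = complex_of_real s ^ n * R s" for s
  proof -
    have "complex_of_real (s ^ l * p (circle_node n j)) =
        (\<Sum>a\<le>degree P. \<Sum>b\<le>degree (coeff P a).
          coeff (coeff P a) b * complex_of_real s ^ (a + b) * (z j ^ a * cnj (z j) ^ b))" for j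
    proof -
      have "s *\<^sub>R circle_node n j = vector [Re (of_real s * z j), Im (of_real s * z j), 0]"
        by (simp add: circle_node_def z_def vec_eq_iff forall_3)
      then have "s ^ l * p (circle_node n j) = p (vector [Re (of_real s * z j), Im (of_real s * z j), 0])"
        using p unfolding homogeneous_polynomial_def by metis
      then show ?thesis
        by (simp only: P poly_poly_eq_sum) (simp add: power_mult_distrib power_add mult_ac)
    qed
    note eq = this
    have "complex_of_real (s ^ l * G) = (\<Sum>j<2*n. (-1) ^ j * complex_of_real (s ^ l * p (circle_node n j)))"
      by (simp add: G_def sum_distrib_left mult.left_commute)
    also have "\<dots> = (\<Sum>a\<le>degree P. \<Sum>b\<le>degree (coeff P a). \<kappa> a b * complex_of_real s ^ (a + b))"
      unfolding eq \<kappa>_def sum_distrib_left sum_distrib_right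
      by (subst sum.swap, rule sum.cong[OF refl], subst sum.swap) (simp add: mult_ac)
    also have "\<dots> = complex_of_real s ^ n * R s"
      by (simp only: R_def sum_distrib_left \<kappa>)
    finally show ?thesis .
  qed
  \<comment> \<open>Cancelling s^l is possible only for \<open>s \<noteq> 0\<close>. The left side
    is constant and the right side tends to 0 with \<open>s\<close>, because
    \<open>n - l > 0\<close>.\<close>
  have "complex_of_real G = complex_of_real s ^ (n - l) * R s" if "s \<noteq> 0" for s
  proof -
    have "complex_of_real s ^ l * of_real G = complex_of_real s ^ l * (complex_of_real s ^ (n - l) * R s)"
      using scaled[of s] l by (simp add: mult.assoc[symmetric] flip: power_add)
    then show ?thesis using that by simp
  qed
  then have "((\<lambda>s. complex_of_real s ^ (n - l) * R s) \<longlongrightarrow> complex_of_real G) (at 0)"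
    by (intro tendsto_eventually) (auto simp: eventually_at_filter)
  moreover have "((\<lambda>s. complex_of_real s ^ (n - l) * R s) \<longlongrightarrow> of_real 0 ^ (n - l) * R 0) (at 0)"
    unfolding R_def by (intro tendsto_intros)
  ultimately have "complex_of_real G = of_real 0 ^ (n - l) * R 0"
    by (intro tendsto_unique) auto
  then have "complex_of_real G = 0" using l by simp
  then show ?thesis by (simp only: of_real_eq_0_iff G_def)
qed

section \<open>Sectoral harmonics\<close>

definition sectoral :: "nat \<Rightarrow> real^3 \<Rightarrow> real" where
  "sectoral n x = Re (Complex (x$1) (x$2) ^ n)"

text \<open>The n-th power turns the angle pi j / n into pi j. As \<open>sectoral\<close> carries no
  normalising factor, its values at the nodes are exactly the signs of the alternating sum.\<close>

lemma sectoral_circle_node: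
  assumes "n > 0"
  shows "sectoral n (circle_node n j) = (-1) ^ j"
proof -
  have "Complex (circle_node n j $ 1) (circle_node n j $ 2) = cis (pi * real j / real n)"
    by (simp add: circle_node_def complex_eq_iff)
  then have "sectoral n (circle_node n j) = Re (cis (real j * pi))"
    using assms by (simp add: sectoral_def Complex.DeMoivre mult_ac)
  also have "cis (real j * pi) = (-1) ^ j" using Complex.DeMoivre[of pi j] by (simp only: cis_pi)
  finally show ?thesis by (metis Re_complex_of_real of_real_1 of_real_minus of_real_power)
qed

text \<open>Multiplication by x + i y mixes real and imaginary parts, so the induction carries
  both.\<close>

lemma real_polynomial_function_Re_power:
  "real_polynomial_function (\<lambda>x::real^3. Re (Complex (x$1) (x$2) ^ n)) \<and>
   real_polynomial_function (\<lambda>x::real^3. Im (Complex (x$1) (x$2) ^ n))"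
proof (induction n)
  case 0
  show ?case by (auto intro: real_polynomial_function.intros(2))
next
  case (Suc n)
  have "real_polynomial_function (\<lambda>x::real^3. x $ i)" for i
    by (intro real_polynomial_function.intros(1) bounded_linear_vec_nth)
  then show ?case using Suc by (auto intro!: real_polynomial_function_diff real_polynomial_function.intros(3,4))
qed

text \<open>The function depends on \<open>\<zeta>\<close> alone, whose gradient \<open>a\<close> =
  (1, i, 0) satisfies a . a = 0; the second derivative along axis \<open>i\<close> is
  \<open>a i * a i\<close> times a factor common to all axes.\<close>

lemma laplacian_sectoral: "laplacian (sectoral n) x = 0"
proof -
  define \<zeta> where "\<zeta> = (\<lambda>x::real^3. Complex (x$1) (x$2))"
  define a :: "3 \<Rightarrow> complex" where "a i = (if i = 1 then 1 else if i = 2 then \<i> else 0)" for i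
  \<comment> \<open>The complex factor \<open>c\<close> makes this family of functions closed under
    \<open>partial_deriv\<close>, so the rule can be applied twice.\<close>
  have pd: "partial_deriv i (\<lambda>x. Re (c * \<zeta> x ^ m)) = (\<lambda>x. Re ((c * of_nat m * a i) * \<zeta> x ^ (m - 1)))"
    for i c m
  proof
    fix x
    have "\<zeta> (x + t *\<^sub>R axis i 1) = \<zeta> x + of_real t * a i" for t
      using exhaust_3[of i] by (auto simp: \<zeta>_def a_def axis_def complex_eq_iff)
    moreover have "((\<lambda>z. c * (\<zeta> x + z * a i) ^ m) has_field_derivative
        c * of_nat m * a i * \<zeta> x ^ (m - 1)) (at (of_real 0))"
      by (auto intro!: derivative_eq_intros)
    note bounded_linear.has_vector_derivative[OF bounded_linear_Re has_vector_derivative_real_field[OF this]]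
    ultimately have "((\<lambda>t. Re (c * \<zeta> (x + t *\<^sub>R axis i 1) ^ m)) has_vector_derivative
        Re (c * of_nat m * a i * \<zeta> x ^ (m - 1))) (at 0)"
      by simp
    then show "partial_deriv i (\<lambda>x. Re (c * \<zeta> x ^ m)) x = Re ((c * of_nat m * a i) * \<zeta> x ^ (m - 1))"
      unfolding partial_deriv_def
      by (intro DERIV_imp_deriv) (simp add: has_real_derivative_iff_has_vector_derivative)
  qed
  have "sectoral n = (\<lambda>x. Re (1 * \<zeta> x ^ n))" by (simp add: fun_eq_iff sectoral_def \<zeta>_def)
  then have "laplacian (sectoral n) x = (\<Sum>i\<in>UNIV. Re (of_nat n * of_nat (n - 1) * \<zeta> x ^ (n - 2) * (a i * a i)))"
    unfolding laplacian_def by (simp only: pd) (simp add: mult_ac numeral_2_eq_2)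
  also have "\<dots> = Re (of_nat n * of_nat (n - 1) * \<zeta> x ^ (n - 2) * (\<Sum>i\<in>UNIV. a i * a i))"
    by (simp only: sum_distrib_left Re_sum)
  also have "(\<Sum>i\<in>UNIV. a i * a i) = 0" by (simp add: sum_3 a_def)
  finally show ?thesis by simp
qed

lemma sectoral_harmonic: "restrict (sectoral n) S2 \<in> spherical_harmonics n"
proof -
  have "Complex (t * x$1) (t * x$2) = of_real t * Complex (x$1) (x$2)" for t and x :: "real^3"
    by (simp add: complex_eq_iff)
  then have "sectoral n (t *\<^sub>R x) = t ^ n * sectoral n x" for t x
    by (simp add: sectoral_def power_mult_distrib flip: of_real_power)
  then show ?thesis
    using real_polynomial_function_Re_power[of n] laplacian_sectoral[of n]
    unfolding spherical_harmonics_def homogeneous_polynomial_def sectoral_def by blast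
qed

section \<open>Integration on the sphere\<close>

lemma finite_surface_measure: "finite_measure surface_measure"
  by (rule finite_measureI) (simp add: emeasure_surface_measure_S2)

lemma measure_surface_measure_S2: "measure surface_measure S2 = 4 * pi"
  by (simp add: measure_def emeasure_surface_measure_S2)

lemma borel_measurable_surface_measure:
  assumes "continuous_on S2 f"
  shows "f \<in> borel_measurable surface_measure"
  using borel_measurable_continuous_on_restrict[OF assms] sets_surface_measure
  by (metis measurable_cong_sets)

lemma compact_S2: "compact S2" by (simp add: S2_def)

lemma continuous_on_S2_bound:
  fixes f :: "real^3 \<Rightarrow> real"
  assumes "continuous_on S2 f"
  obtains B where "\<And>x. x \<in> S2 \<Longrightarrow> \<bar>f x\<bar> \<le> B"
proof -
  have "bounded (f ` S2)"
    using assms compact_S2 compact_continuous_image compact_imp_bounded by blast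
  then show ?thesis using that by (force simp: bounded_iff)
qed

lemma integrable_surface_measure:
  fixes f :: "real^3 \<Rightarrow> real"
  assumes "continuous_on S2 f"
  shows "integrable surface_measure f"
proof -
  interpret finite_measure surface_measure by (rule finite_surface_measure)
  obtain B where B: "\<And>x. x \<in> S2 \<Longrightarrow> \<bar>f x\<bar> \<le> B" using continuous_on_S2_bound[OF assms] by blast
  then show ?thesis
    by (intro integrable_const_bound[of _ B] AE_I2 borel_measurable_surface_measure assms) auto
qed

text \<open>The cone over the equator lies in a plane, a Lebesgue null set. Hence Riemann sums may
  avoid the equator, and the decay of \<open>sectoral n\<close> need only be checked off it.\<close>

lemma AE_surface_measure_off_equator: "AE x in surface_measure. x $ 3 \<noteq> 0"
proof -
  let ?N = "{x \<in> S2. x $ 3 = 0}"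
  have "closed (S2 \<inter> {x. x $ 3 = 0})"
    unfolding S2_def by (intro closed_Int closed_sphere closed_Collect_eq continuous_intros)
  also have "S2 \<inter> {x. x $ 3 = 0} = ?N" by blast
  finally have N: "?N \<in> sets (restrict_space borel S2)"
    by (auto simp: sets_restrict_space_iff S2_def)
  have "emeasure lborel {x \<in> cball 0 1 - {0}. sgn x \<in> ?N} = 0"
  proof -
    have "negligible {x :: real^3. axis 3 1 \<bullet> x = 0}"
      by (rule negligible_hyperplane) (simp add: axis_eq_0_iff)
    then have "negligible {x :: real^3. x $ 3 = 0}"
      by (simp add: inner_axis' )
    then have "{x :: real^3. x $ 3 = 0} \<in> null_sets lborel"
      by (simp add: negligible_iff_null_sets null_sets_completion_iff)
    moreover have "{x \<in> cball 0 1 - {0}. sgn x \<in> ?N} \<subseteq> {x :: real^3. x $ 3 = 0}"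
      by (auto simp: sgn_div_norm)
    ultimately show ?thesis by (meson emeasure_eq_0 null_setsD1 null_setsD2)
  qed
  then have "emeasure surface_measure ?N = 0"
    using emeasure_surface_measure[OF N] by simp
  then show ?thesis
    using N by (intro AE_I[of _ _ ?N]) (auto simp: sets_surface_measure)
qed

section \<open>The \<open>L2\<close> inner product\<close>

lemma L2_inner_cong:
  "(\<And>x. x \<in> S2 \<Longrightarrow> f x = f' x) \<Longrightarrow> (\<And>x. x \<in> S2 \<Longrightarrow> g x = g' x) \<Longrightarrow> L2_inner f g = L2_inner f' g'"
  unfolding L2_inner_def sphere_integral_def by (intro Bochner_Integration.integral_cong) auto

lemma L2_inner_commute: "L2_inner f g = L2_inner g f"
  by (simp add: L2_inner_def mult.commute)

lemma L2_inner_sum_left: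
  assumes "\<And>i. i \<in> I \<Longrightarrow> continuous_on S2 (f i)" "continuous_on S2 g"
  shows "L2_inner (\<lambda>x. \<Sum>i\<in>I. c i * f i x) g = (\<Sum>i\<in>I. c i * L2_inner (f i) g)"
proof -
  have "L2_inner (\<lambda>x. \<Sum>i\<in>I. c i * f i x) g = (LINT x|surface_measure. (\<Sum>i\<in>I. c i * (f i x * g x)))"
    by (simp add: L2_inner_def sphere_integral_def sum_distrib_right mult.assoc)
  also have "\<dots> = (\<Sum>i\<in>I. c i * L2_inner (f i) g)"
    unfolding L2_inner_def sphere_integral_def
    by (subst Bochner_Integration.integral_sum)
       (auto intro!: integrable_mult_right integrable_surface_measure continuous_on_mult assms)
  finally show ?thesis .
qed

lemma L2_norm_nonneg: "0 \<le> L2_norm f"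
  by (simp add: L2_norm_def L2_inner_def sphere_integral_def)

lemma L2_norm_power2: "L2_norm f ^ 2 = L2_inner f f"
  by (simp add: L2_norm_def L2_inner_def sphere_integral_def)

text \<open>The integral of (f + t g)^2 is a quadratic polynomial in \<open>t\<close> that is
  nowhere negative.\<close>

lemma L2_Cauchy_Schwarz:
  assumes f: "continuous_on S2 f" and g: "continuous_on S2 g"
  shows "\<bar>L2_inner f g\<bar> \<le> L2_norm f * L2_norm g"
proof -
  have *: "0 \<le> L2_inner f f + 2 * t * L2_inner f g + t\<^sup>2 * L2_inner g g" for t
  proof -
    have "0 \<le> (LINT x|surface_measure. (f x + t * g x)\<^sup>2)" by simp
    also have "\<dots> = (LINT x|surface_measure. f x * f x + 2 * t * (f x * g x) + t\<^sup>2 * (g x * g x))"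
      by (simp add: power2_eq_square algebra_simps)
    also have "\<dots> = L2_inner f f + 2 * t * L2_inner f g + t\<^sup>2 * L2_inner g g"
      unfolding L2_inner_def sphere_integral_def
      by (simp add: integrable_surface_measure continuous_on_mult f g)
    finally show ?thesis .
  qed
  have "(L2_inner f g)\<^sup>2 \<le> L2_inner f f * L2_inner g g"
  proof (cases "L2_inner g g = 0")
    case True
    have "L2_inner f g = 0"
    proof (rule ccontr)
      assume nz: "L2_inner f g \<noteq> 0"
      \<comment> \<open>With \<open>L2_inner g g = 0\<close> the polynomial is affine in
        \<open>t\<close>, and this \<open>t\<close> gives it the value -1. The other case inserts
        the minimiser.\<close>
      have "0 \<le> L2_inner f f + 2 * (- (L2_inner f f + 1) / (2 * L2_inner f g)) * L2_inner f g"
        using *[of "- (L2_inner f f + 1) / (2 * L2_inner f g)"] True by simp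
      then show False using nz by (simp add: field_simps)
    qed
    then show ?thesis using True by simp
  next
    case False
    then have "L2_inner g g > 0" using L2_norm_power2[of g] by (metis order_le_less zero_le_power2)
    then show ?thesis
      using *[of "- L2_inner f g / L2_inner g g"] by (simp add: field_simps power2_eq_square)
  qed
  then have "(L2_inner f g)\<^sup>2 \<le> (L2_norm f * L2_norm g)\<^sup>2"
    by (simp add: power_mult_distrib L2_norm_power2)
  then show ?thesis
    by (metis abs_le_square_iff abs_of_nonneg L2_norm_nonneg mult_nonneg_nonneg)
qed

text \<open>Cut the sphere without its equator into small cells, sample one point per cell, and take
  the surface measure of the cell as weight. The sum is the integral of a step function, so
  dominated convergence applies; the equator is a null set. Keeping nodes off the equator leaves
  room for a bump function.\<close>

lemma Riemann_quadrature:
  "\<exists>X w. \<forall>n. finite (X n) \<and> X n \<subseteq> S2 \<inter> {x. x $ 3 \<noteq> 0} \<and> (\<forall>x. 0 \<le> w n x) \<and>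
     (\<Sum>x\<in>X n. w n x) \<le> 4 * pi \<and>
     (\<forall>f. continuous_on S2 f \<longrightarrow> (\<lambda>n. \<Sum>x\<in>X n. w n x * f x) \<longlonglongrightarrow> sphere_integral f)"
proof -
  interpret finite_measure surface_measure by (rule finite_surface_measure)
  define U where "U = S2 \<inter> {x. x $ 3 \<noteq> 0}"
  \<comment> \<open>The label of the grid cube of side \<open>1 / n\<close> that contains
    \<open>x\<close>; for \<open>n = 0\<close> there is a single cell.\<close>
  define g where "g n x = (\<lfloor>real n * x $ 1\<rfloor>, \<lfloor>real n * x $ 2\<rfloor>, \<lfloor>real n * x $ 3\<rfloor>)" for n :: nat and x :: "real^3"
  define piece where "piece n v = U \<inter> g n -` {v}" for n v
  \<comment> \<open>Meaningful only for labels \<open>v\<close> of nonempty cells, that is, in the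
    image of \<open>U\<close> under \<open>g n\<close>.\<close>
  define pt where "pt n v = (SOME x. x \<in> piece n v)" for n v
  define X where "X n = pt n ` g n ` U" for n
  define w where "w n x = measure surface_measure (piece n (g n x))" for n x
  have pt: "pt n (g n x) \<in> U" "g n (pt n (g n x)) = g n x" if "x \<in> U" for n x
  proof -
    have "pt n (g n x) \<in> piece n (g n x)" unfolding pt_def
      by (rule someI[of _ x]) (simp add: piece_def that)
    then show "pt n (g n x) \<in> U" "g n (pt n (g n x)) = g n x" by (auto simp: piece_def)
  qed
  have fin: "finite (g n ` U)" for n
  proof (rule finite_subset)
    show "g n ` U \<subseteq> {- int n..int n} \<times> {- int n..int n} \<times> {- int n..int n}"
    proof -
      have "- int n \<le> \<lfloor>real n * x $ i\<rfloor>" "\<lfloor>real n * x $ i\<rfloor> \<le> int n" if "x \<in> U" for x i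
      proof -
        have "\<bar>x $ i\<bar> \<le> 1" using component_le_norm_cart[of x i] that by (simp add: U_def S2_def)
        then have "\<bar>real n * x $ i\<bar> \<le> real n" by (simp add: abs_mult mult_left_le)
        then show "- int n \<le> \<lfloor>real n * x $ i\<rfloor>" "\<lfloor>real n * x $ i\<rfloor> \<le> int n" by linarith+
      qed
      then show ?thesis by (auto simp: g_def)
    qed
  qed simp
  have ps: "piece n v \<in> sets surface_measure" for n v
  proof -
    obtain a b c where v: "v = (a, b, c)" by (cases v)
    have "piece n v = U \<inter> {x. \<lfloor>real n * x $ 1\<rfloor> = a \<and> \<lfloor>real n * x $ 2\<rfloor> = b \<and> \<lfloor>real n * x $ 3\<rfloor> = c}"
      by (auto simp: piece_def g_def v)
    also have "\<dots> \<in> sets borel" unfolding U_def S2_def by measurable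
    finally have "piece n v \<in> sets borel" .
    moreover have "piece n v \<subseteq> S2" by (auto simp: piece_def U_def)
    ultimately show ?thesis by (auto simp: sets_surface_measure sets_restrict_space_iff S2_def)
  qed
  have pS: "piece n v \<inter> S2 = piece n v" for n v
    by (auto simp: piece_def U_def)
  define s where "s f n x = (\<Sum>v\<in>g n ` U. f (pt n v) * indicator (piece n v) x)"
    for f :: "real^3 \<Rightarrow> real" and n x
  have s: "s f n x = f (pt n (g n x))" if "x \<in> U" for f n x
  proof -
    have "s f n x = (\<Sum>v\<in>g n ` U. if v = g n x then f (pt n v) else 0)"
      unfolding s_def by (intro sum.cong) (auto simp: piece_def that)
    also have "\<dots> = f (pt n (g n x))" using that fin by (simp add: sum.delta')
    finally show ?thesis .
  qed
  have quad: "(\<Sum>x\<in>X n. w n x * f x) = (LINT x|surface_measure. s f n x)" for f n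
  proof -
    \<comment> \<open>The label of a sample point is that of its cell, so different cells have
      different sample points and weights can be indexed by nodes.\<close>
    have "inj_on (pt n) (g n ` U)" by (rule inj_onI) (metis imageE pt(2))
    then have "(\<Sum>x\<in>X n. w n x * f x) = (\<Sum>v\<in>g n ` U. w n (pt n v) * f (pt n v))"
      by (simp add: X_def sum.reindex)
    also have "\<dots> = (\<Sum>v\<in>g n ` U. f (pt n v) * measure surface_measure (piece n v))"
      by (intro sum.cong refl) (auto simp: w_def pt(2))
    also have "\<dots> = (LINT x|surface_measure. s f n x)"
      unfolding s_def using ps pS
      by (subst Bochner_Integration.integral_sum) (auto simp: emeasure_eq_measure)
    finally show ?thesis .
  qed
  have smeas: "s f n \<in> borel_measurable surface_measure" for f n
    unfolding s_def using ps by measurable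
  have AEU: "AE x in surface_measure. x \<in> U"
    using AE_surface_measure_off_equator by (auto simp: U_def elim: AE_mp)
  have conv: "(\<lambda>n. \<Sum>x\<in>X n. w n x * f x) \<longlonglongrightarrow> sphere_integral f" if f: "continuous_on S2 f" for f
  proof -
    obtain B where B: "\<And>x. x \<in> S2 \<Longrightarrow> \<bar>f x\<bar> \<le> B" using continuous_on_S2_bound[OF f] by blast
    have lim: "(\<lambda>n. s f n x) \<longlonglongrightarrow> f x" if x: "x \<in> U" for x
    proof -
      have "(\<lambda>n. pt n (g n x) $ i) \<longlonglongrightarrow> x $ i" for i
      proof (rule LIM_zero_cancel, rule Lim_null_comparison)
        show "\<forall>\<^sub>F n in sequentially. norm (pt n (g n x) $ i - x $ i) \<le> 1 / real n"
          using eventually_gt_at_top[of 0]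
        proof eventually_elim
          case (elim n)
          \<comment> \<open>Sharing a cell means sharing all three floors, which bounds each
            coordinate difference by \<open>1 / n\<close>.\<close>
          have "\<lfloor>real n * pt n (g n x) $ i\<rfloor> = \<lfloor>real n * x $ i\<rfloor>"
            using pt(2)[OF x, of n] exhaust_3[of i] unfolding g_def by auto
          then have "\<bar>real n * pt n (g n x) $ i - real n * x $ i\<bar> \<le> 1" by linarith
          then have "real n * \<bar>pt n (g n x) $ i - x $ i\<bar> \<le> 1"
            by (simp add: abs_mult flip: right_diff_distrib)
          then show ?case using elim by (simp add: field_simps)
        qed
      qed (rule lim_1_over_n)
      then have "(\<lambda>n. pt n (g n x)) \<longlonglongrightarrow> x" by (rule vec_tendstoI)
      then have "(\<lambda>n. f (pt n (g n x))) \<longlonglongrightarrow> f x"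
        using f x pt(1)[OF x] unfolding U_def
        by (intro continuous_on_tendsto_compose[OF f]) auto
      then show ?thesis using s[OF x] by simp
    qed
    have "(\<lambda>n. LINT x|surface_measure. s f n x) \<longlonglongrightarrow> (LINT x|surface_measure. f x)"
    proof (rule integral_dominated_convergence[where w = "\<lambda>_. B"])
      show "AE x in surface_measure. (\<lambda>n. s f n x) \<longlonglongrightarrow> f x"
        using AEU by eventually_elim (rule lim)
      show "AE x in surface_measure. norm (s f n x) \<le> B" for n
        using AEU by eventually_elim (use s pt(1) B in \<open>auto simp: U_def\<close>)
    qed (auto intro: smeas borel_measurable_surface_measure f)
    then show ?thesis by (simp add: quad sphere_integral_def)
  qed
  have "(\<Sum>x\<in>X n. w n x) \<le> 4 * pi" for n
  proof -
    have "(\<Sum>x\<in>X n. w n x) = (LINT x|surface_measure. s (\<lambda>_. 1) n x)"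
      using quad[of n "\<lambda>_. 1"] by simp
    also have "\<dots> \<le> (LINT x|surface_measure. 1)"
    proof (rule integral_mono_AE)
      show "integrable surface_measure (s (\<lambda>_. 1) n)"
        unfolding s_def using ps by (auto simp: emeasure_eq_measure)
      show "AE x in surface_measure. s (\<lambda>_. 1) n x \<le> 1"
        using AEU by eventually_elim (simp add: s)
    qed simp
    also have "\<dots> = 4 * pi" by (simp add: measure_surface_measure_S2)
    finally show ?thesis .
  qed
  moreover have "finite (X n)" "X n \<subseteq> U" for n
    using fin pt(1) by (auto simp: X_def)
  ultimately show ?thesis using conv unfolding U_def
    by (intro exI[of _ X] exI[of _ w]) (auto simp: w_def)
qed

section \<open>Hyperinterpolation\<close>

text \<open>On the sphere |x + i y|^2 = 1 - (\<open>x$3\<close>)^2, which is below 1 off the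
  equator. So the powers tend to 0 almost everywhere, dominated by the constant 1.\<close>

lemma sectoral_tendsto_0: "(\<lambda>n. L2_norm (sectoral n)) \<longlonglongrightarrow> 0"
proof -
  have bound: "\<bar>sectoral n x\<bar> \<le> cmod (Complex (x$1) (x$2)) ^ n" for n x
    unfolding sectoral_def norm_power[symmetric] by (rule abs_Re_le_cmod)
  have S2_coord: "(x$1)\<^sup>2 + (x$2)\<^sup>2 + (x$3)\<^sup>2 = 1" if "x \<in> S2" for x
    using that by (simp add: S2_def norm_eq_1 inner_vec_def sum_3 power2_eq_square)
  have "(\<lambda>n. LINT x|surface_measure. sectoral n x * sectoral n x)
      \<longlonglongrightarrow> (LINT x|surface_measure. 0)"
  proof (rule integral_dominated_convergence[where w = "\<lambda>_. 1"])
    interpret finite_measure surface_measure by (rule finite_surface_measure)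
    show "integrable surface_measure (\<lambda>_. 1 :: real)" by simp
    have "continuous_on S2 (sectoral n)" for n
      using real_polynomial_function_Re_power[of n]
      by (auto simp: sectoral_def[abs_def] real_polynomial_function_eq intro: continuous_on_polymonial_function)
    then show "(\<lambda>x. sectoral n x * sectoral n x) \<in> borel_measurable surface_measure" for n
      by (intro borel_measurable_surface_measure continuous_on_mult)
    show "AE x in surface_measure. (\<lambda>n. sectoral n x * sectoral n x) \<longlonglongrightarrow> 0"
      using AE_surface_measure_off_equator AE_space
    proof eventually_elim
      case (elim x)
      then have "(x$3)\<^sup>2 > 0" "(x$1)\<^sup>2 + (x$2)\<^sup>2 + (x$3)\<^sup>2 = 1" using S2_coord by simp_all
      then have "(x$1)\<^sup>2 + (x$2)\<^sup>2 < 1" by linarith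
      then have "cmod (Complex (x$1) (x$2)) < 1" by (simp add: cmod_def)
      then have "(\<lambda>n. cmod (Complex (x$1) (x$2)) ^ n) \<longlonglongrightarrow> 0" by (intro LIMSEQ_power_zero) simp
      then have "(\<lambda>n. sectoral n x) \<longlonglongrightarrow> 0"
        by (rule Lim_null_comparison[rotated]) (simp add: bound)
      then show ?case using tendsto_mult_zero by blast
    qed
    show "AE x in surface_measure. norm (sectoral n x * sectoral n x) \<le> 1" for n
    proof (rule AE_I2)
      fix x assume "x \<in> space surface_measure"
      then have "(x$1)\<^sup>2 + (x$2)\<^sup>2 + (x$3)\<^sup>2 = 1" using S2_coord by simp
      then have "(x$1)\<^sup>2 + (x$2)\<^sup>2 \<le> 1" using zero_le_power2[of "x$3"] by linarith
      then have "cmod (Complex (x$1) (x$2)) \<le> 1" by (simp add: cmod_def)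
      then have "\<bar>sectoral n x\<bar> \<le> 1" using bound[of n x] power_le_one[of "cmod (Complex (x$1) (x$2))" n] by simp
      then show "norm (sectoral n x * sectoral n x) \<le> 1"
        by (simp only: real_norm_def abs_mult mult_le_one abs_ge_zero)
    qed
  qed auto
  then have "(\<lambda>n. sqrt (L2_inner (sectoral n) (sectoral n))) \<longlonglongrightarrow> sqrt 0"
    by (intro tendsto_real_sqrt) (simp add: L2_inner_def sphere_integral_def)
  then show ?thesis by (simp add: L2_norm_def)
qed

text \<open>Nodes must be pairwise distinct while \<open>\<phi>\<close> may repeat points: weights
  that fall on the same point are added up, and the triangle inequality keeps their absolute sum
  from growing.\<close>

lemma quadrature_of_nodes:
  assumes J: "finite J" "J \<noteq> {}" "\<phi> ` J \<subseteq> S2"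
  shows "\<exists>Q. quadrature_formula Q \<and> (\<forall>f. quad_apply Q f = (\<Sum>j\<in>J. c j * f (\<phi> j))) \<and>
    (\<Sum>j=1..num_nodes Q. \<bar>weight Q j\<bar>) \<le> (\<Sum>j\<in>J. \<bar>c j\<bar>)"
proof -
  define X where "X = \<phi> ` J"
  define w where "w x = (\<Sum>j\<in>{j\<in>J. \<phi> j = x}. c j)" for x
  have X: "finite X" "X \<noteq> {}" using J by (auto simp: X_def)
  obtain e where e: "bij_betw e {1..card X} X"
    using ex_bij_betw_nat_finite_1[OF X(1)] by blast
  define Q where "Q = \<lparr>num_nodes = card X, node = e, weight = w \<circ> e\<rparr>"
  have "quadrature_formula Q"
    using e X J by (auto simp: quadrature_formula_def Q_def bij_betw_def X_def Suc_le_eq card_gt_0_iff)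
  moreover have "quad_apply Q f = (\<Sum>j\<in>J. c j * f (\<phi> j))" for f
  proof -
    have "quad_apply Q f = (\<Sum>x\<in>X. w x * f x)"
      using sum.reindex_bij_betw[OF e, of "\<lambda>x. w x * f x"] by (simp add: quad_apply_def Q_def)
    also have "\<dots> = (\<Sum>x\<in>X. \<Sum>j\<in>{j\<in>J. \<phi> j = x}. c j * f (\<phi> j))"
      by (auto simp: w_def sum_distrib_right intro!: sum.cong)
    also have "\<dots> = (\<Sum>j\<in>J. c j * f (\<phi> j))"
      using J by (intro sum.group) (auto simp: X_def)
    finally show ?thesis .
  qed
  moreover have "(\<Sum>j=1..num_nodes Q. \<bar>weight Q j\<bar>) \<le> (\<Sum>j\<in>J. \<bar>c j\<bar>)"
  proof -
    have "(\<Sum>j=1..num_nodes Q. \<bar>weight Q j\<bar>) = (\<Sum>x\<in>X. \<bar>w x\<bar>)"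
      using sum.reindex_bij_betw[OF e, of "\<lambda>x. \<bar>w x\<bar>"] by (simp add: Q_def)
    also have "\<dots> \<le> (\<Sum>x\<in>X. \<Sum>j\<in>{j\<in>J. \<phi> j = x}. \<bar>c j\<bar>)"
      unfolding w_def by (intro sum_mono sum_abs)
    also have "\<dots> = (\<Sum>j\<in>J. \<bar>c j\<bar>)"
      using J by (intro sum.group) (auto simp: X_def)
    finally show ?thesis .
  qed
  ultimately show ?thesis by blast
qed

section \<open>Spherical harmonics and the alternating mean\<close>

lemma spherical_harmonic_continuous:
  assumes "h \<in> spherical_harmonics l"
  shows "continuous_on S2 h"
proof -
  obtain p where p: "h = restrict p S2" "real_polynomial_function p"
    using assms by (auto simp: spherical_harmonics_def homogeneous_polynomial_def)
  then have "continuous_on S2 p"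
    by (simp add: real_polynomial_function_eq continuous_on_polymonial_function)
  then show ?thesis unfolding p(1) by (rule continuous_on_eq) simp
qed

lemma sectoral_continuous: "continuous_on S2 (sectoral n)"
  using spherical_harmonic_continuous[OF sectoral_harmonic[of n]] by (rule continuous_on_eq) simp

lemma circle_node_in_S2: "circle_node n j \<in> S2"
  by (simp add: circle_node_def S2_def norm_eq_1 inner_vec_def sum_3 flip: power2_eq_square)

definition alternating_mean :: "nat \<Rightarrow> (real^3 \<Rightarrow> real) \<Rightarrow> real" where
  "alternating_mean n f = (\<Sum>j<2*n. (-1) ^ j / (2 * real n) * f (circle_node n j))"

lemma alternating_mean_harmonic:
  assumes "h \<in> spherical_harmonics l" "l < n"
  shows "alternating_mean n h = 0"
proof -
  obtain p where p: "h = restrict p S2" "homogeneous_polynomial l p"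
    using assms by (auto simp: spherical_harmonics_def)
  have "alternating_mean n h = (\<Sum>j<2*n. (-1) ^ j * p (circle_node n j)) / (2 * real n)"
    by (simp add: alternating_mean_def p(1) circle_node_in_S2 sum_divide_distrib)
  then show ?thesis using alternating_sum_homogeneous[OF p(2) assms(2)] by simp
qed

lemma alternating_mean_sectoral:
  "n > 0 \<Longrightarrow> alternating_mean n (sectoral n) = 1"
  by (simp add: alternating_mean_def sectoral_circle_node flip: power_mult_distrib)

lemma alternating_mean_sum:
  assumes "\<And>x. x \<in> S2 \<Longrightarrow> f x = (\<Sum>i\<in>I. c i * g i x)"
  shows "alternating_mean n f = (\<Sum>i\<in>I. c i * alternating_mean n (g i))"
  unfolding alternating_mean_def sum_distrib_left
  by (subst sum.swap) (simp add: assms circle_node_in_S2 sum_distrib_left sum_divide_distrib mult_ac)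

section \<open>Inner products of hyperinterpolants\<close>

lemma harmonic_onb_continuous:
  "harmonic_onb l Y \<Longrightarrow> k \<in> {- int l..int l} \<Longrightarrow> continuous_on S2 (Y k)"
  unfolding harmonic_onb_def using spherical_harmonic_continuous by blast

lemma L2_inner_hyperinterpolation:
  assumes Y: "\<And>l. harmonic_onb l (Y l)" and g: "continuous_on S2 g"
  shows "L2_inner (hyperinterpolation Y n Q f) g =
    (\<Sum>l\<le>n. \<Sum>k=- int l..int l. quad_apply Q (\<lambda>y. f y * Y l k y) * L2_inner (Y l k) g)"
proof -
  \<comment> \<open>Pairs of degree and order form one index set, so that the linearity lemma for a
    single finite sum applies.\<close>
  let ?I = "SIGMA l:{..n}. {- int l..int l}"
  let ?q = "\<lambda>(l, k). quad_apply Q (\<lambda>y. f y * Y l k y)" and ?Y = "\<lambda>(l, k). Y l k"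
  have "L2_inner (hyperinterpolation Y n Q f) g = L2_inner (\<lambda>x. \<Sum>i\<in>?I. ?q i * ?Y i x) g"
    by (intro L2_inner_cong) (simp_all add: hyperinterpolation_def sum.Sigma split_def)
  also have "\<dots> = (\<Sum>i\<in>?I. ?q i * L2_inner (?Y i) g)"
    using harmonic_onb_continuous[OF Y] g by (intro L2_inner_sum_left) auto
  finally show ?thesis by (simp add: sum.Sigma split_def)
qed

lemma hyperinterpolation_continuous:
  assumes Y: "\<And>l. harmonic_onb l (Y l)"
  shows "continuous_on S2 (hyperinterpolation Y n Q f)"
proof -
  have "continuous_on S2 (\<lambda>x. \<Sum>l\<le>n. \<Sum>k=- int l..int l. quad_apply Q (\<lambda>y. f y * Y l k y) * Y l k x)"
    using harmonic_onb_continuous[OF Y] by (intro continuous_on_sum continuous_on_mult continuous_on_const) auto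
  then show ?thesis
    unfolding hyperinterpolation_def by (rule continuous_on_eq) simp
qed

text \<open>The assumption on \<open>Q\<close> is what a bump function \<open>f\<close> provides.
  Coefficients of degree below \<open>n\<close> vanish; in degree \<open>n\<close> the inner
  products are the expansion coefficients of \<open>sectoral n\<close>, so linearity of the mean
  reassembles its value at \<open>sectoral n\<close>.\<close>

lemma L2_inner_hyperinterpolation_sectoral:
  assumes Y: "\<And>l. harmonic_onb l (Y l)" and n: "n > 0"
    and Q: "\<And>g. quad_apply Q (\<lambda>y. f y * g y) = alternating_mean n g"
  shows "L2_inner (hyperinterpolation Y n Q f) (sectoral n) = 1"
proof -
  let ?K = "{- int n..int n}"
  have "restrict (sectoral n) S2 \<in> spherical_harmonics n" by (rule sectoral_harmonic)
  then obtain c where "\<forall>x\<in>S2. restrict (sectoral n) S2 x = (\<Sum>k\<in>?K. c k * Y n k x)"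
    using Y[of n] unfolding harmonic_onb_def by blast
  then have c: "sectoral n x = (\<Sum>k\<in>?K. c k * Y n k x)" if "x \<in> S2" for x
    using that by simp
  \<comment> \<open>Orthonormality within degree \<open>n\<close> identifies the inner products with
    the coefficients \<open>c k\<close>.\<close>
  have coeff: "L2_inner (Y n k) (sectoral n) = c k" if k: "k \<in> ?K" for k
  proof -
    have "L2_inner (Y n k) (sectoral n) = L2_inner (\<lambda>x. \<Sum>j\<in>?K. c j * Y n j x) (Y n k)"
      by (subst L2_inner_commute) (intro L2_inner_cong c refl)
    also have "\<dots> = (\<Sum>j\<in>?K. c j * L2_inner (Y n j) (Y n k))"
      using harmonic_onb_continuous[OF Y] k by (intro L2_inner_sum_left) auto
    also have "\<dots> = (\<Sum>j\<in>?K. if j = k then c j else 0)"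
      using Y[of n] k unfolding harmonic_onb_def by (intro sum.cong) auto
    also have "\<dots> = c k" using k by simp
    finally show ?thesis .
  qed
  have lower: "alternating_mean n (Y l k) = 0" if "l < n" "k \<in> {- int l..int l}" for l k
    using Y[of l] that alternating_mean_harmonic unfolding harmonic_onb_def by blast
  have "L2_inner (hyperinterpolation Y n Q f) (sectoral n) =
      (\<Sum>l\<le>n. \<Sum>k=- int l..int l. alternating_mean n (Y l k) * L2_inner (Y l k) (sectoral n))"
    by (simp only: L2_inner_hyperinterpolation[OF Y sectoral_continuous] Q)
  also have "\<dots> = (\<Sum>l\<le>n. if l = n then \<Sum>k\<in>?K. c k * alternating_mean n (Y n k) else 0)"
    by (intro sum.cong refl) (auto simp: lower coeff mult.commute intro!: sum.neutral)
  also have "\<dots> = alternating_mean n (sectoral n)"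
    by (simp add: alternating_mean_sum[OF c])
  finally show ?thesis using n by (simp add: alternating_mean_sectoral)
qed

section \<open>Divergence of the hyperinterpolation operators\<close>

lemma bounded_linear_apply_bcontfun:
  "bounded_linear (\<lambda>f :: 'a::topological_space \<Rightarrow>\<^sub>C 'b::real_normed_vector. apply_bcontfun f x)"
  by (rule bounded_linear_intro[where K = 1]) (auto simp: norm_bounded)

text \<open>Otherwise the functionals \<open>\<Lambda> n\<close>, inner products with the normalised
  sectoral harmonic, would be pointwise and hence uniformly bounded, yet \<open>\<Lambda> n\<close>
  takes the value 1 / \<open>L2_norm (sectoral n)\<close> at \<open>F n\<close>. The Banach space is
  that of bounded continuous functions on all of \<open>real^3\<close>, which is why
  \<open>F n\<close> is continuous on \<open>UNIV\<close>.\<close>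

lemma limsup_hyperinterpolation_infinite:
  assumes Y: "\<And>l. harmonic_onb l (Y l)"
    and F: "\<And>n. n \<ge> 1 \<Longrightarrow> continuous_on UNIV (F n)" "\<And>n x. n \<ge> 1 \<Longrightarrow> \<bar>F n x\<bar> \<le> 1"
    and L: "\<And>n. n \<ge> 1 \<Longrightarrow> L2_inner (hyperinterpolation Y n (Q n) (F n)) (sectoral n) = 1"
  shows "\<exists>f\<in>C_S2. limsup (\<lambda>n. ereal (L2_norm (hyperinterpolation Y n (Q n) f))) = \<infinity>"
proof (rule ccontr)
  assume neg: "\<not> ?thesis"
  define \<Lambda> :: "nat \<Rightarrow> ((real^3) \<Rightarrow>\<^sub>C real) \<Rightarrow> real" where
    "\<Lambda> n f = L2_inner (hyperinterpolation Y n (Q n) f) (sectoral n) / L2_norm (sectoral n)" for n f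
  have lin: "bounded_linear (\<Lambda> n)" for n
    unfolding \<Lambda>_def L2_inner_hyperinterpolation[OF Y sectoral_continuous] quad_apply_def divide_inverse
    by (intro bounded_linear_mult_const bounded_linear_const_mult bounded_linear_sum bounded_linear_apply_bcontfun)
  \<comment> \<open>Cauchy-Schwarz; if the denominator is 0, the quotient is 0 by
    convention.\<close>
  have le: "\<bar>\<Lambda> n f\<bar> \<le> L2_norm (hyperinterpolation Y n (Q n) f)" for n f
    using L2_Cauchy_Schwarz[OF hyperinterpolation_continuous[OF Y] sectoral_continuous]
      L2_norm_nonneg[of "sectoral n"] L2_norm_nonneg
    by (cases "L2_norm (sectoral n) > 0") (simp_all add: \<Lambda>_def pos_divide_le_eq abs_divide order_less_le)
  have bdd: "\<exists>B. \<forall>n. norm (\<Lambda> n f) \<le> B" for f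
  proof -
    have "apply_bcontfun f \<in> C_S2" by (simp add: C_S2_def)
    then have "limsup (\<lambda>n. ereal (L2_norm (hyperinterpolation Y n (Q n) f))) < \<infinity>"
      using neg by (metis ereal_infty_less(1))
    then obtain B where "limsup (\<lambda>n. ereal (L2_norm (hyperinterpolation Y n (Q n) f))) < ereal B"
      using less_PInf_Ex_of_nat by (metis ereal_dense2)
    then have "\<forall>\<^sub>F n in sequentially. ereal (L2_norm (hyperinterpolation Y n (Q n) f)) < ereal B"
      by (rule Limsup_lessD)
    then have "\<forall>\<^sub>F n in sequentially. norm (\<Lambda> n f) \<le> B"
    proof eventually_elim
      case (elim n)
      then show ?case using le[of n f] by simp
    qed
    \<comment> \<open>The finitely many initial terms only enlarge the constant.\<close>
    then have "Bseq (\<lambda>n. \<Lambda> n f)" by (rule BfunI)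
    then show ?thesis by (auto simp: Bseq_def)
  qed
  obtain C where C: "\<And>n f. norm (\<Lambda> n f) \<le> C * norm f"
    using uniform_boundedness[of \<Lambda>, OF lin bdd] by blast
  have "1 \<le> \<bar>C\<bar> * L2_norm (sectoral n)" if n: "n \<ge> 1" for n
  proof -
    define f where "f = Bcontfun (F n)"
    have "F n \<in> bcontfun" by (rule bcontfun_normI[where b = 1]) (use F n in auto)
    then have f: "apply_bcontfun f = F n" by (simp add: f_def Bcontfun_inverse)
    have "norm f \<le> 1" by (rule norm_bound) (use F n f in auto)
    have "\<Lambda> n f \<le> C * norm f" using C[of n f] by simp
    also have "\<dots> \<le> \<bar>C\<bar> * 1" using \<open>norm f \<le> 1\<close> by (intro mult_mono) auto
    finally have "\<Lambda> n f \<le> \<bar>C\<bar>" by simp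
    \<comment> \<open>A zero norm would contradict Cauchy-Schwarz, since the inner product in
      \<open>L\<close> is 1.\<close>
    moreover have "L2_norm (sectoral n) > 0"
      using L2_Cauchy_Schwarz[OF hyperinterpolation_continuous[OF Y] sectoral_continuous, of n "Q n" "F n" n] L[OF n]
        L2_norm_nonneg[of "sectoral n"]
      by (cases "L2_norm (sectoral n) = 0") auto
    ultimately show ?thesis using L[OF n] by (simp add: \<Lambda>_def f divide_le_eq)
  qed
  then have "\<forall>\<^sub>F n in sequentially. 1 \<le> \<bar>C\<bar> * L2_norm (sectoral n)"
    using eventually_ge_at_top by (rule eventually_mono[rotated])
  moreover have "(\<lambda>n. \<bar>C\<bar> * L2_norm (sectoral n)) \<longlonglongrightarrow> \<bar>C\<bar> * 0"
    by (intro tendsto_intros sectoral_tendsto_0)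
  ultimately have "1 \<le> \<bar>C\<bar> * 0" by (intro tendsto_lowerbound) auto
  then show False by simp
qed

text \<open>\<open>F n\<close> is admissible in the supremum, and by Cauchy-Schwarz its image has
  norm at least 1 / \<open>L2_norm (sectoral n)\<close>.\<close>

lemma op_norm_hyperinterpolation_tendsto:
  assumes Y: "\<And>l. harmonic_onb l (Y l)"
    and F: "\<And>n. n \<ge> 1 \<Longrightarrow> continuous_on UNIV (F n)" "\<And>n x. n \<ge> 1 \<Longrightarrow> \<bar>F n x\<bar> \<le> 1"
    and L: "\<And>n. n \<ge> 1 \<Longrightarrow> L2_inner (hyperinterpolation Y n (Q n) (F n)) (sectoral n) = 1"
  shows "(\<lambda>n. op_norm_C_L2 (hyperinterpolation Y n (Q n))) \<longlonglongrightarrow> \<infinity>"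
  unfolding tendsto_PInfty
proof
  fix r :: real
  \<comment> \<open>This threshold forces the norm of the image to be at least
    \<open>\<bar>r\<bar> + 1\<close>, which exceeds \<open>r\<close>.\<close>
  have "\<forall>\<^sub>F n in sequentially. L2_norm (sectoral n) < 1 / (\<bar>r\<bar> + 1)"
    by (rule order_tendstoD(2)[OF sectoral_tendsto_0]) (simp add: add_nonneg_pos)
  with eventually_ge_at_top[of 1]
  show "\<forall>\<^sub>F n in sequentially. ereal r < op_norm_C_L2 (hyperinterpolation Y n (Q n))"
  proof eventually_elim
    case (elim n)
    let ?g = "hyperinterpolation Y n (Q n) (F n)"
    have "1 \<le> L2_norm ?g * L2_norm (sectoral n)"
      using L2_Cauchy_Schwarz[OF hyperinterpolation_continuous[OF Y] sectoral_continuous, of n "Q n" "F n" n] L elim by simp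
    also have "\<dots> \<le> L2_norm ?g * (1 / (\<bar>r\<bar> + 1))"
      using elim L2_norm_nonneg by (intro mult_left_mono) auto
    finally have "ereal r < ereal (L2_norm ?g)" by (simp add: field_simps)
    also have "ereal (L2_norm ?g) \<le> op_norm_C_L2 (hyperinterpolation Y n (Q n))"
    proof -
      have "S2 \<noteq> {}" using circle_node_in_S2 by blast
      then have "sup_norm (F n) \<le> 1"
        unfolding sup_norm_def using F elim by (intro cSUP_least) auto
      moreover have "F n \<in> C_S2" using F elim by (auto simp: C_S2_def intro: continuous_on_subset)
      ultimately show ?thesis unfolding op_norm_C_L2_def by (intro SUP_upper) auto
    qed
    finally show ?case .
  qed
qed

section \<open>Construction of the quadrature formulas\<close>

theorem theorem4p5:
  fixes Y :: "nat \<Rightarrow> int \<Rightarrow> real^3 \<Rightarrow> real"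
  assumes "\<And>l. harmonic_onb l (Y l)"
  shows "\<exists>Q :: nat \<Rightarrow> quadrature.
    (\<forall>n\<ge>1. quadrature_formula (Q n)) \<and>
    (\<exists>M>0. \<forall>n\<ge>1. (\<Sum>j=1..num_nodes (Q n). \<bar>weight (Q n) j\<bar>) \<le> M) \<and>
    (\<forall>p\<in>spherical_polynomials.
       (\<lambda>n. \<bar>quad_apply (Q n) p - sphere_integral p\<bar>) \<longlonglongrightarrow> 0) \<and>
    (\<lambda>n. op_norm_C_L2 (hyperinterpolation Y n (Q n))) \<longlonglongrightarrow> \<infinity> \<and>
    (\<exists>f\<in>C_S2. limsup (\<lambda>n. ereal (L2_norm (hyperinterpolation Y n (Q n) f))) = \<infinity>)"
proof -
  obtain X w where fin: "\<And>n. finite (X n)" and X: "\<And>n. X n \<subseteq> S2 \<inter> {x. x $ 3 \<noteq> 0}"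
    and w: "\<And>n x. 0 \<le> w n x" and sum_w: "\<And>n. (\<Sum>x\<in>X n. w n x) \<le> 4 * pi"
    and conv: "\<And>f. continuous_on S2 f \<Longrightarrow> (\<lambda>n. \<Sum>x\<in>X n. w n x * f x) \<longlonglongrightarrow> sphere_integral f"
    using Riemann_quadrature by blast
  \<comment> \<open>The guard allows a choice for all \<open>n\<close> at once; at
    \<open>n = 0\<close>, where there are no equatorial nodes, any record serves.\<close>
  have "\<exists>Q. n \<ge> 1 \<longrightarrow> quadrature_formula Q \<and>
      (\<forall>f. quad_apply Q f = alternating_mean n f + (\<Sum>x\<in>X n. w n x * f x)) \<and>
      (\<Sum>j=1..num_nodes Q. \<bar>weight Q j\<bar>) \<le> 1 + 4 * pi" for n
  proof (cases "n \<ge> 1")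
    case True
    let ?J = "{..<2*n} <+> X n" and ?\<phi> = "case_sum (circle_node n) id"
      and ?c = "case_sum (\<lambda>j. (-1) ^ j / (2 * real n)) (w n)"
    \<comment> \<open>The \<open>2 * n\<close> equatorial weights have modulus
      \<open>1 / (2 * n)\<close> each, and the Riemann weights are nonnegative.\<close>
    have "(\<Sum>j\<in>?J. \<bar>?c j\<bar>) = 1 + (\<Sum>x\<in>X n. w n x)"
      using True fin w by (simp add: sum.Plus abs_divide power_abs)
    then have le: "(\<Sum>j\<in>?J. \<bar>?c j\<bar>) \<le> 1 + 4 * pi" using sum_w by simp
    have J: "finite ?J" "?J \<noteq> {}" "?\<phi> ` ?J \<subseteq> S2"
      using True fin X[of n] circle_node_in_S2 by (auto simp: Plus_eq_empty_conv lessThan_empty_iff)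
    obtain Q where Q: "quadrature_formula Q" "\<And>f. quad_apply Q f = (\<Sum>j\<in>?J. ?c j * f (?\<phi> j))"
      "(\<Sum>j=1..num_nodes Q. \<bar>weight Q j\<bar>) \<le> (\<Sum>j\<in>?J. \<bar>?c j\<bar>)"
      using quadrature_of_nodes[OF J, of ?c] by blast
    have "quad_apply Q f = alternating_mean n f + (\<Sum>x\<in>X n. w n x * f x)" for f
      using fin by (simp add: Q(2) sum.Plus alternating_mean_def)
    then show ?thesis using Q(1,3) le by force
  qed blast
  then obtain Q where Q: "\<And>n. n \<ge> 1 \<Longrightarrow> quadrature_formula (Q n)"
    "\<And>n f. n \<ge> 1 \<Longrightarrow> quad_apply (Q n) f = alternating_mean n f + (\<Sum>x\<in>X n. w n x * f x)"
    "\<And>n. n \<ge> 1 \<Longrightarrow> (\<Sum>j=1..num_nodes (Q n). \<bar>weight (Q n) j\<bar>) \<le> 1 + 4 * pi"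
    by metis
  have poly: "(\<lambda>n. \<bar>quad_apply (Q n) p - sphere_integral p\<bar>) \<longlonglongrightarrow> 0"
    if "p \<in> spherical_polynomials" for p
  proof -
    obtain N h where h: "\<And>l. l \<le> N \<Longrightarrow> h l \<in> spherical_harmonics l"
      and p: "p = restrict (\<lambda>x. \<Sum>l\<le>N. h l x) S2"
      using \<open>p \<in> spherical_polynomials\<close> by (auto simp: spherical_polynomials_def spherical_polynomials_upto_def)
    have "continuous_on S2 (\<lambda>x. \<Sum>l\<le>N. h l x)"
      using h spherical_harmonic_continuous by (intro continuous_on_sum) auto
    then have "continuous_on S2 p" unfolding p by (rule continuous_on_eq) simp
    from conv[OF this] have "(\<lambda>n. (\<Sum>x\<in>X n. w n x * p x) - sphere_integral p) \<longlonglongrightarrow> 0"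
      by (rule LIM_zero)
    \<comment> \<open>Once \<open>n > N\<close>, all degrees in \<open>p\<close> are below
      \<open>n\<close>, so the alternating mean of \<open>p\<close> is 0 and only the Riemann sum
      remains.\<close>
    moreover have "\<forall>\<^sub>F n in sequentially.
        (\<Sum>x\<in>X n. w n x * p x) - sphere_integral p = quad_apply (Q n) p - sphere_integral p"
      using eventually_gt_at_top[of N]
    proof eventually_elim
      case (elim n)
      have "alternating_mean n p = (\<Sum>l\<le>N. 1 * alternating_mean n (h l))"
        by (rule alternating_mean_sum) (simp add: p)
      also have "\<dots> = 0" using h elim alternating_mean_harmonic by (intro sum.neutral) force
      finally show ?case using elim by (simp add: Q(2))
    qed
    ultimately have "(\<lambda>n. quad_apply (Q n) p - sphere_integral p) \<longlonglongrightarrow> 0"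
      using tendsto_cong by fast
    then show ?thesis by (rule tendsto_rabs_zero)
  qed
  have bump: "\<exists>f :: real^3 \<Rightarrow> real. continuous_on UNIV f \<and> (\<forall>x. \<bar>f x\<bar> \<le> 1) \<and>
      (\<forall>x\<in>X n. f x = 0) \<and> (\<forall>j. f (circle_node n j) = 1)" for n
  proof -
    \<comment> \<open>Urysohn's lemma is applied to the whole equatorial plane, a closed set that
      contains all circle nodes and misses \<open>X n\<close>.\<close>
    define E :: "(real^3) set" where "E = {x. x $ 3 = 0}"
    have "closed E" unfolding E_def by (intro closed_Collect_eq continuous_intros)
    moreover have "closed (X n)" using fin finite_imp_closed by blast
    moreover have "X n \<inter> E = {}" using X by (auto simp: E_def)
    ultimately obtain f :: "real^3 \<Rightarrow> real" where f: "continuous_on UNIV f"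
      "\<And>x. f x \<in> closed_segment 0 1" "\<And>x. x \<in> X n \<Longrightarrow> f x = 0" "\<And>x. x \<in> E \<Longrightarrow> f x = 1"
      using Urysohn[of "X n" E 0 1] by metis
    have "\<bar>f x\<bar> \<le> 1" for x using f(2)[of x] by (simp add: closed_segment_eq_real_ivl)
    moreover have "circle_node n j \<in> E" for j by (simp add: circle_node_def E_def)
    ultimately show ?thesis using f(1,3,4) by (intro exI[of _ f]) simp
  qed
  have "\<exists>F :: nat \<Rightarrow> real^3 \<Rightarrow> real. \<forall>n. continuous_on UNIV (F n) \<and> (\<forall>x. \<bar>F n x\<bar> \<le> 1) \<and>
      (\<forall>x\<in>X n. F n x = 0) \<and> (\<forall>j. F n (circle_node n j) = 1)"
    by (intro choice allI bump)
  then obtain F :: "nat \<Rightarrow> real^3 \<Rightarrow> real" where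
    F: "\<And>n. continuous_on UNIV (F n)" "\<And>n x. \<bar>F n x\<bar> \<le> 1"
    "\<And>n x. x \<in> X n \<Longrightarrow> F n x = 0" "\<And>n j. F n (circle_node n j) = 1"
    by blast
  have L: "L2_inner (hyperinterpolation Y n (Q n) (F n)) (sectoral n) = 1" if "n \<ge> 1" for n
  proof (rule L2_inner_hyperinterpolation_sectoral[OF assms])
    show "0 < n" using that by simp
    \<comment> \<open>The factor \<open>F n\<close> deletes the Riemann part and leaves the
      equatorial part unchanged.\<close>
    show "quad_apply (Q n) (\<lambda>y. F n y * g y) = alternating_mean n g" for g
      by (simp add: Q(2)[OF that] F(3,4) alternating_mean_def)
  qed
  have "(\<lambda>n. op_norm_C_L2 (hyperinterpolation Y n (Q n))) \<longlonglongrightarrow> \<infinity>"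
    by (rule op_norm_hyperinterpolation_tendsto[OF assms F(1,2) L])
  moreover have "\<exists>f\<in>C_S2. limsup (\<lambda>n. ereal (L2_norm (hyperinterpolation Y n (Q n) f))) = \<infinity>"
    by (rule limsup_hyperinterpolation_infinite[OF assms F(1,2) L])
  moreover have "\<exists>M>0. \<forall>n\<ge>1. (\<Sum>j=1..num_nodes (Q n). \<bar>weight (Q n) j\<bar>) \<le> M"
    using Q(3) by (intro exI[of _ "1 + 4 * pi"]) (simp add: add_pos_pos)
  ultimately show ?thesis using Q(1) poly by (intro exI[of _ Q]) simp
qed

end
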